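(* Let $q$ be an odd prime power. Let $a,b,c\in\mathbb{F}_q$ with $b\neq 0$, and suppose that $4ab+2c$ is a non-square in $\mathbb{F}_q$. Then the polynomial $$f(x)=b(x+a)^2+c(x+a)-a+\frac{c^2-2c}{4b}\in\mathbb{F}_q[x]$$ is stable over $\mathbb{F}_q$ if and only if $q\equiv 1\pmod 4$.
   Context: For a field $K$, a polynomial $t(x)\in K[x]$ is called stable over $K$ if for every integer $n\ge 1$ the $n$-th iterate $t^{(n)}(x)=t(t(\cdots t(x)\cdots))$ ($n$-fold composition) is irreducible over $K$. A non-square in $\mathbb{F}_q$ is an element of $\mathbb{F}_q$ that is not of the form $s^2$ with $s\in\mathbb{F}_q$ (in particular $0$ is a square). *)

theory Defs
  imports
    "HOL-Library.Cardinality"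
    "HOL-Computational_Algebra.Computational_Algebra"
    "HOL-Number_Theory.Prime_Powers"
    "HOL-Number_Theory.Cong"
begin

definition poly_iterate :: "nat \<Rightarrow> 'a::comm_semiring_1 poly \<Rightarrow> 'a poly" where
  "poly_iterate n t = (pcompose t ^^ n) [:0, 1:]"

definition stable_poly :: "'a::field poly \<Rightarrow> bool" where
  "stable_poly t \<longleftrightarrow> (\<forall>n\<ge>1. irreducible (poly_iterate n t))"

end

theory Submission
  imports Defs
begin

text \<open>
  Completing the square gives $f(x) = b (x + d)^2 - d$ with $d = a + c / (2 b)$, hence
  $b f^{(n)}(x) = L^{2^n} - e$ for $L = b x + b d$ and $e = b d$, and $4 e = 4 a b + 2 c$ shows
  that $e$ is a non-square.

  If $q \equiv 3 \pmod 4$, then $-1$ is a non-square, so $-e = s^2$ where the sign of $s$ can be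
  chosen such that $2 s = r^2$; then $L^4 - e = (L^2 + s)^2 - (r L)^2$ factors.

  If $q \equiv 1 \pmod 4$, let $p$ be an irreducible factor of $L^{2^n} - e$ of degree
  $m < 2^n$. Then $q^m - 1 = (q - 1) 2^j t$ with $j < n$ and $t$ odd. Raising
  $L^{q^m - 1} \equiv 1 \pmod p$ to the power $2^{n - 1 - j}$ gives
  $1 \equiv (L^{2^n})^{t (q - 1) / 2} \equiv e^{t (q - 1) / 2} = (-1)^t = -1$,
  which is impossible.
\<close>

section \<open>Irreducible factors of polynomials over a field\<close>

lemma irreducible_polyI:
  fixes p :: "'a::field poly"
  assumes "degree p > 0" and "\<And>a b. p = a * b \<Longrightarrow> degree a = 0 \<or> degree b = 0"
  shows "irreducible p"
proof (rule irreducibleI)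
  show "p \<noteq> 0" "\<not> p dvd 1"
    using assms(1) dvd_imp_degree_le[of p 1] by auto
  show "a dvd 1 \<or> b dvd 1" if "p = a * b" for a b
    using assms(2)[OF that] \<open>p \<noteq> 0\<close> that by (auto simp: is_unit_iff_degree)
qed

lemma irreducible_poly_factor_exists:
  fixes f :: "'a::field poly"
  assumes "degree f > 0"
  obtains p where "irreducible p" "p dvd f"
proof -
  have "\<exists>p. irreducible p \<and> p dvd f"
    using assms
  proof (induction "degree f" arbitrary: f rule: less_induct)
    case less
    show ?case
    proof (cases "irreducible f")
      case False
      then obtain a b where ab: "f = a * b" "degree a \<noteq> 0" "degree b \<noteq> 0"
        using irreducible_polyI[of f] less.prems by blast
      moreover have "degree f = degree a + degree b"
        using ab less.prems by (intro degree_mult_eq[of a b, folded ab(1)]) auto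
      ultimately obtain p where "irreducible p" "p dvd a"
        using less.hyps[of a] by auto
      then show ?thesis
        using ab(1) by auto
    qed auto
  qed
  then show thesis
    using that by blast
qed

section \<open>Fermat's little theorem modulo an irreducible polynomial\<close>

text \<open>Taking \<open>n\<close> to be the degree of a modulus, this counts its residues. The
  disjunct \<open>p = 0\<close> matters only for \<open>n = 0\<close>, where it keeps the zero
  polynomial.\<close>

lemma card_poly_degree_less:
  "finite {p :: 'a::{finite,zero} poly. p = 0 \<or> degree p < n}
   \<and> card {p :: 'a poly. p = 0 \<or> degree p < n} = CARD('a) ^ n"
proof (induction n)
  case 0
  have "{p :: 'a poly. p = 0 \<or> degree p < 0} = {0}"
    by auto
  then show ?case
    by simp
next
  case (Suc n)
  let ?S = "\<lambda>n. {p :: 'a poly. p = 0 \<or> degree p < n}"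
  have "?S (Suc n) = (\<lambda>(a, p). pCons a p) ` (UNIV \<times> ?S n)"
  proof (intro equalityI subsetI)
    fix p assume p: "p \<in> ?S (Suc n)"
    obtain a r where [simp]: "p = pCons a r"
      by (cases p)
    show "p \<in> (\<lambda>(a, p). pCons a p) ` (UNIV \<times> ?S n)"
      using p by (auto split: if_splits)
  qed (auto simp: degree_pCons_eq_if split: if_splits)
  moreover have "inj_on (\<lambda>(a, p). pCons a p) (UNIV \<times> ?S n)"
    by (auto simp: inj_on_def)
  ultimately show ?case
    using Suc.IH by (simp add: card_image card_cartesian_product)
qed

lemma irreducible_poly_dvd_prod:
  fixes p :: "'a::field poly"
  assumes "irreducible p" "finite A" "p dvd prod f A"
  shows "\<exists>x\<in>A. p dvd f x"
  using assms(2,3)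
proof (induction A rule: finite_induct)
  case empty
  then show ?case
    using assms(1) by (simp add: irreducible_def)
next
  case (insert x A)
  then show ?case
    using field_poly_irreducible_imp_prime[OF assms(1)] by (auto simp: prime_elem_dvd_mult_iff)
qed

text \<open>Multiplication by \<open>a\<close> permutes the nonzero residues modulo
  \<open>p\<close>. Comparing the product of all of them before and after, and cancelling it, leaves
  the power of \<open>a\<close>.\<close>

lemma fermat_mod_irreducible_poly:
  fixes a p :: "'a::finite_field poly"
  assumes p: "irreducible p" and a: "\<not> p dvd a"
  shows "[a ^ (CARD('a) ^ degree p - 1) = 1] (mod p)"
proof -
  define S where "S = {r :: 'a poly. r = 0 \<or> degree r < degree p} - {0}"
  have prime: "prime_elem p"
    by (rule field_poly_irreducible_imp_prime[OF p])
  have [simp]: "p \<noteq> 0"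
    using p by auto
  have "finite S" and card_S: "card S = CARD('a) ^ degree p - 1"
    using card_poly_degree_less[of "degree p", where ?'a = 'a] by (auto simp: S_def)
  have not_dvd: "\<not> p dvd r" if "r \<in> S" for r
    using that dvd_imp_degree_le[of p r] by (auto simp: S_def)
  have closed: "(a * r) mod p \<in> S" if "r \<in> S" for r
  proof -
    have "\<not> p dvd a * r"
      using a not_dvd[OF that] prime by (simp add: prime_elem_dvd_mult_iff)
    then show ?thesis
      using degree_mod_less[of p "a * r"] by (auto simp: S_def mod_eq_0_iff_dvd)
  qed
  have "inj_on (\<lambda>r. (a * r) mod p) S"
  proof (rule inj_onI)
    fix r s assume rs: "r \<in> S" "s \<in> S" "(a * r) mod p = (a * s) mod p"
    then have "p dvd a * (r - s)"
      by (simp add: mod_eq_dvd_iff right_diff_distrib)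
    then have "p dvd r - s"
      using a prime by (simp add: prime_elem_dvd_mult_iff)
    moreover have "r - s \<noteq> 0 \<Longrightarrow> degree (r - s) < degree p"
      using rs degree_diff_less[of r "degree p" s] by (auto simp: S_def)
    ultimately show "r = s"
      using dvd_imp_degree_le[of p "r - s"] by fastforce
  qed
  then have "(\<lambda>r. (a * r) mod p) ` S = S"
    using closed \<open>finite S\<close> by (intro endo_inj_surj) auto
  then have "\<Prod>S = (\<Prod>r\<in>S. (a * r) mod p)"
    using \<open>inj_on _ S\<close> by (metis (no_types, lifting) prod.reindex_cong)
  moreover have "[(\<Prod>r\<in>S. (a * r) mod p) = (\<Prod>r\<in>S. a * r)] (mod p)"
    by (intro cong_prod) (simp add: cong_def)
  ultimately have "[a ^ card S * \<Prod>S = 1 * \<Prod>S] (mod p)"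
    by (simp add: prod.distrib cong_sym)
  then have "p dvd (a ^ card S - 1) * \<Prod>S"
    by (simp add: cong_iff_dvd_diff left_diff_distrib)
  moreover have "\<not> p dvd \<Prod>S"
    using irreducible_poly_dvd_prod[OF p \<open>finite S\<close>, of "\<lambda>r. r"] not_dvd by blast
  ultimately show ?thesis
    using prime by (simp add: prime_elem_dvd_mult_iff cong_iff_dvd_diff card_S)
qed

section \<open>Euler's criterion and the 2-adic valuation of q^m - 1\<close>

text \<open>A counting argument: otherwise \<open>e ^ h = 1\<close>, so \<open>e\<close> and all
  nonzero squares are roots of X^h - 1, which leaves at most h - 1 nonzero squares. Squaring is at
  most two-to-one, so these cannot account for all 2h nonzero elements.\<close>

lemma euler_criterion_finite_field:
  fixes e :: "'a::finite_field"
  assumes q: "CARD('a) = 2 * h + 1" and e: "\<not> is_square e"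
  shows "e ^ h = - 1"
proof (rule ccontr)
  assume neq: "e ^ h \<noteq> - 1"
  have pow1: "x ^ (2 * h) = 1" if "x \<noteq> 0" for x :: 'a
    using finite_field_power_card_eq_same[of x] that by (simp add: q)
  have "e \<noteq> 0"
    using e by auto
  then have "(e ^ h)\<^sup>2 = 1"
    using pow1[of e] by (simp add: power_mult[symmetric] mult.commute)
  then have "e ^ h = 1"
    using neq by (simp add: power2_eq_1_iff)
  have "CARD('a) > 1"
    using card_mono[of UNIV "{0, 1 :: 'a}"] by simp
  then have "h > 0"
    using q by simp
  let ?p = "monom 1 h - 1 :: 'a poly"
  have "coeff ?p h = 1"
    using \<open>h > 0\<close> by simp
  then have "?p \<noteq> 0"
    by fastforce
  have deg: "degree ?p \<le> h"
    by (intro degree_diff_le degree_monom_le) auto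
  define R Q where "R = {x :: 'a. poly ?p x = 0}" and "Q = (\<lambda>x :: 'a. x\<^sup>2) ` (UNIV - {0})"
  have "insert e Q \<subseteq> R"
    using \<open>e ^ h = 1\<close> pow1 by (auto simp: R_def Q_def poly_monom power_mult[symmetric])
  moreover have "card R \<le> h"
    using card_poly_roots_bound[OF \<open>?p \<noteq> 0\<close>] deg unfolding R_def by linarith
  moreover have "e \<notin> Q"
    using e by (auto simp: Q_def is_nth_power_def)
  ultimately have card_Q: "card Q + 1 \<le> h"
    using card_mono[of R "insert e Q"] by simp
  have fibre: "card {x :: 'a. x\<^sup>2 = y} \<le> 2" for y
  proof (cases "\<exists>s. y = s\<^sup>2")
    case True
    then obtain s where "y = s\<^sup>2" by blast
    then have "{x :: 'a. x\<^sup>2 = y} \<subseteq> {s, - s}"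
      by (auto simp: power2_eq_iff)
    then have "card {x :: 'a. x\<^sup>2 = y} \<le> card {s, - s}"
      by (intro card_mono) auto
    also have "\<dots> \<le> 2"
      by (simp add: card_insert_if)
    finally show ?thesis .
  next
    case False
    then have empty: "{x. x\<^sup>2 = y} = {}"
      by auto
    show ?thesis
      by (simp add: empty)
  qed
  have "2 * h = card (UNIV - {0 :: 'a})"
    by (simp add: q card_Diff_singleton)
  also have "\<dots> \<le> card (\<Union>y\<in>Q. {x. x\<^sup>2 = y})"
    by (intro card_mono) (auto simp: Q_def)
  also have "\<dots> \<le> (\<Sum>y\<in>Q. card {x. x\<^sup>2 = y})"
    by (intro card_UN_le) (auto simp: Q_def)
  also have "\<dots> \<le> (\<Sum>y\<in>Q. 2)"
    by (intro sum_mono fibre)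
  finally show False
    using card_Q by simp
qed

text \<open>Write \<open>m = 2 ^ j * k\<close> with \<open>k\<close> odd. For exponent
  \<open>k\<close>, the cofactor of \<open>q - 1\<close> is a sum of \<open>k\<close> odd terms.
  Each squaring step from x to x^2 multiplies x - 1 by x + 1, which is 2 modulo 4 because 4 divides
  \<open>q - 1\<close>, so exactly one factor 2 is gained.\<close>

lemma power_minus_one_two_adic:
  fixes q m :: nat
  assumes q: "q mod 4 = 1" and m: "0 < m" "m < 2 ^ n"
  obtains j t where "j < n" "odd t" "q ^ m = 1 + (q - 1) * 2 ^ j * t"
proof -
  define j where "j = multiplicity 2 m"
  obtain k where m_eq: "m = 2 ^ j * k" and "odd k"
    unfolding j_def by (rule multiplicity_decompose'[of m 2]) (use m(1) in auto)
  have "2 ^ j \<le> m"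
    using \<open>odd k\<close> by (simp add: m_eq Suc_leI odd_pos)
  then have "(2::nat) ^ j < 2 ^ n"
    using m(2) by linarith
  then have "j < n"
    by simp
  have "odd q"
    using q by presburger
  have "\<exists>t. odd t \<and> q ^ (2 ^ j * k) = 1 + (q - 1) * 2 ^ j * t"
  proof (induction j)
    case 0
    have "odd (\<Sum>i<k. q ^ i)"
      using \<open>odd k\<close> \<open>odd q\<close> by (simp add: even_sum_iff)
    moreover have "q ^ k = 1 + (q - 1) * (\<Sum>i<k. q ^ i)"
    proof (induction k)
      case (Suc k)
      have "q ^ Suc k = q ^ k + (q - 1) * q ^ k"
        using \<open>odd q\<close> by (cases q) auto
      then show ?case
        unfolding sum.lessThan_Suc distrib_left using Suc.IH by linarith
    qed simp
    ultimately show ?case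
      by auto
  next
    case (Suc j)
    then obtain t where t: "odd t" "q ^ (2 ^ j * k) = 1 + (q - 1) * 2 ^ j * t"
      by blast
    let ?u = "(q - 1) div 2 * 2 ^ j * t"
    have qm: "q - 1 = 2 * ((q - 1) div 2)" and "even ((q - 1) div 2)"
      using q by presburger+
    have "q ^ (2 ^ Suc j * k) = (q ^ (2 ^ j * k))\<^sup>2"
      by (simp add: power_mult[symmetric] mult_ac)
    also have "\<dots> = 1 + (q - 1) * 2 ^ j * t * (2 + (q - 1) * 2 ^ j * t)"
      unfolding t by (simp add: power2_eq_square algebra_simps)
    also have "2 + (q - 1) * 2 ^ j * t = 2 * (1 + ?u)"
      by (subst qm) (simp add: algebra_simps)
    finally have "q ^ (2 ^ Suc j * k) = 1 + (q - 1) * 2 ^ Suc j * (t * (1 + ?u))"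
      by (simp only: power_Suc mult_ac)
    moreover have "odd (t * (1 + ?u))"
      using t(1) \<open>even ((q - 1) div 2)\<close> by simp
    ultimately show ?case
      by blast
  qed
  then show thesis
    using that \<open>j < n\<close> m_eq by blast
qed

section \<open>Irreducibility and factorization of L^(2^n) - e\<close>

text \<open>Every irreducible factor has at least the full degree \<open>2 ^ n\<close>, so in any
  factorization a nonconstant factor leaves only degree 0 for the other.\<close>

lemma irreducible_two_power_minus_nonsquare:
  fixes e :: "'a::finite_field" and l :: "'a poly"
  assumes q: "CARD('a) mod 4 = 1" and e: "\<not> is_square e" and l: "degree l = 1"
  shows "irreducible (l ^ 2 ^ n - [:e:])"
proof -
  let ?q = "CARD('a)" and ?f = "l ^ 2 ^ n - [:e:]"
  define h where "h = (?q - 1) div 2"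
  have qh: "?q = 2 * h + 1"
    using q unfolding h_def by presburger
  have "e \<noteq> 0"
    using e by auto
  have "(2 :: 'a) \<noteq> 0"
  proof
    \<comment> \<open>In characteristic 2 squaring is injective, hence surjective on a finite field,
      so \<open>e\<close> would be a square.\<close>
    assume "(2 :: 'a) = 0"
    then have "inj (\<lambda>x :: 'a. x\<^sup>2)"
      by (intro injI) (metis power2_eq_iff add.inverse_unique mult_2 mult_zero_left)
    then have "surj (\<lambda>x :: 'a. x\<^sup>2)"
      by (rule finite_UNIV_inj_surj[OF finite])
    then show False
      using e by (metis is_nth_power_nth_power surjD)
  qed
  have "degree (l ^ 2 ^ n) = 2 ^ n"
    using l by (subst degree_power_eq) auto
  then have deg_f: "degree ?f = 2 ^ n"
    by (subst diff_conv_add_uminus, subst degree_add_eq_left) auto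
  have deg_ge: "2 ^ n \<le> degree p" if p: "irreducible p" "p dvd ?f" for p
  proof (rule ccontr)
    assume "\<not> 2 ^ n \<le> degree p"
    moreover have "degree p > 0"
      using p(1) by (auto simp: irreducible_def is_unit_iff_degree)
    ultimately obtain j t where jt: "j < n" "odd t" "?q ^ degree p = 1 + (?q - 1) * 2 ^ j * t"
      using power_minus_one_two_adic[OF q, of "degree p" n] by auto
    have root: "[l ^ 2 ^ n = [:e:]] (mod p)"
      using p(2) by (simp add: cong_iff_dvd_diff)
    have "\<not> p dvd l"
    proof
      assume "p dvd l"
      then have "p dvd l ^ 2 ^ n"
        by (simp add: dvd_power_le[of p l 1 "2 ^ n"] dvd_trans)
      then have "p dvd [:e:]"
        using p(2) dvd_diff[of p "l ^ 2 ^ n" ?f] by simp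
      then show False
        using \<open>e \<noteq> 0\<close> \<open>degree p > 0\<close> dvd_imp_degree_le[of p "[:e:]"] by simp
    qed
    \<comment> \<open>The exponent from Fermat is \<open>2 * h * 2 ^ j * t\<close>; the extra power
      supplies the factors 2 missing from \<open>2 ^ n\<close>. The natural subtraction is exact
      since \<open>j < n\<close>.\<close>
    have "[(l ^ (?q ^ degree p - 1)) ^ 2 ^ (n - 1 - j) = 1 ^ 2 ^ (n - 1 - j)] (mod p)"
      by (intro cong_pow fermat_mod_irreducible_poly p(1)) fact
    moreover have "(?q ^ degree p - 1) * 2 ^ (n - 1 - j) = 2 ^ n * (h * t)"
    proof -
      have "(?q ^ degree p - 1) * 2 ^ (n - 1 - j) = 2 ^ (1 + j + (n - 1 - j)) * (h * t)"
        unfolding jt(3) using qh by (simp add: power_add mult_ac)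
      also have "1 + j + (n - 1 - j) = n"
        using jt(1) by simp
      finally show ?thesis .
    qed
    ultimately have "[(l ^ 2 ^ n) ^ (h * t) = 1] (mod p)"
      by (simp add: power_mult[symmetric])
    then have "[[:e:] ^ (h * t) = 1] (mod p)"
      using cong_pow[OF root, of "h * t"] cong_trans cong_sym by blast
    moreover have "[:e:] ^ (h * t) = [:- 1:]"
      using euler_criterion_finite_field[OF qh e] jt(2) by (simp add: poly_const_pow power_mult)
    \<comment> \<open>Now 1 and -1 agree modulo \<open>p\<close>, yet a nonconstant \<open>p\<close>
      cannot divide a nonzero constant.\<close>
    ultimately have "p dvd [:- 2:]"
      by (simp add: cong_iff_dvd_diff one_pCons)
    then show False
      using \<open>(2 :: 'a) \<noteq> 0\<close> \<open>degree p > 0\<close> dvd_imp_degree_le[of p "[:- 2:]"] by simp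
  qed
  show ?thesis
  proof (rule irreducible_polyI)
    fix a b assume ab: "?f = a * b"
    show "degree a = 0 \<or> degree b = 0"
    proof (rule disjCI)
      assume "degree b \<noteq> 0"
      then obtain p where p: "irreducible p" "p dvd b"
        using irreducible_poly_factor_exists by blast
      have "?f \<noteq> 0"
        using deg_f by force
      then have nz: "a \<noteq> 0" "b \<noteq> 0"
        using ab by auto
      have "2 ^ n \<le> degree b"
        using deg_ge[of p] p ab nz dvd_imp_degree_le[of p b] by (metis dvd_mult le_trans)
      then show "degree a = 0"
        using deg_f degree_mult_eq[OF nz] ab by simp
    qed
  qed (simp add: deg_f)
qed

lemma reducible_fourth_power_minus_nonsquare:
  fixes e :: "'a::finite_field" and l :: "'a poly"
  assumes q: "CARD('a) mod 4 = 3" and "(2 :: 'a) \<noteq> 0" and e: "\<not> is_square e"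
    and l: "degree l = 1"
  shows "\<not> irreducible (l ^ 4 - [:e:])"
proof -
  define h where "h = (CARD('a) - 1) div 2"
  have qh: "CARD('a) = 2 * h + 1" and "odd h"
    using q unfolding h_def by presburger+
  have "(1 :: 'a) \<noteq> - 1"
    using \<open>(2 :: 'a) \<noteq> 0\<close> by (metis one_add_one add.right_inverse)
  \<comment> \<open>If both were non-squares, Euler's criterion would give -1 for both
    \<open>x ^ h\<close> and \<open>(- x) ^ h\<close>, but these are negatives of each other as
    \<open>h\<close> is odd.\<close>
  then have neg_square: "is_square x \<or> is_square (- x)" for x :: 'a
    using euler_criterion_finite_field[OF qh, of x] euler_criterion_finite_field[OF qh, of "- x"]
      \<open>odd h\<close> by (metis add.inverse_inverse power_minus_odd)
  obtain s where s: "- e = s\<^sup>2"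
    using neg_square[of e] e by (auto elim: is_nth_powerE)
  \<comment> \<open>Replacing \<open>s\<close> by \<open>- s\<close> keeps its square, and one of
    \<open>2 * s\<close>, \<open>- 2 * s\<close> is a square.\<close>
  obtain s r where s: "- e = s\<^sup>2" and r: "2 * s = r\<^sup>2"
  proof (cases "is_square (2 * s)")
    case True
    then show thesis
      using that s by (auto elim: is_nth_powerE)
  next
    case False
    then have "is_square (2 * (- s))"
      using neg_square[of "2 * s"] by simp
    then show thesis
      using that[of "- s"] s by (auto elim: is_nth_powerE)
  qed
  let ?g = "\<lambda>r. l\<^sup>2 + smult r l + [:s:]"
  have deg: "degree (?g r) = 2" for r
  proof -
    have "degree (l\<^sup>2) = 2"
      using l by (subst degree_power_eq) auto
    moreover have "degree (smult r l + [:s:]) < 2"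
      using l by (intro degree_add_less) (auto intro: le_less_trans[OF degree_smult_le])
    ultimately show ?thesis
      by (simp add: add.assoc degree_add_eq_left)
  qed
  \<comment> \<open>A difference of two squares; the choice \<open>r\<^sup>2 = 2 * s\<close> cancels
    the middle term.\<close>
  have "?g r * ?g (- r) = (l\<^sup>2 + [:s:])\<^sup>2 - [:r\<^sup>2:] * l\<^sup>2"
    by (simp add: power2_eq_square algebra_simps)
  also have "[:r\<^sup>2:] = 2 * [:s:]"
    unfolding r[symmetric] by (simp add: numeral_poly)
  also have "(l\<^sup>2 + [:s:])\<^sup>2 - 2 * [:s:] * l\<^sup>2 = l ^ 4 + [:s\<^sup>2:]"
    by (simp add: power2_eq_square power4_eq_xxxx algebra_simps)
  also have "\<dots> = l ^ 4 - [:e:]"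
    unfolding s[symmetric] by simp
  finally have "l ^ 4 - [:e:] = ?g r * ?g (- r)" ..
  moreover have "\<not> ?g r dvd 1" "\<not> ?g (- r) dvd 1"
    using deg[of r] deg[of "- r"] dvd_imp_degree_le[of "?g r" 1] dvd_imp_degree_le[of "?g (- r)" 1]
    by (metis degree_1 le_zero_eq one_neq_zero zero_neq_numeral)+
  ultimately show ?thesis
    using irreducibleD by blast
qed

section \<open>Iterates of the quadratic and the equivalence\<close>

text \<open>The map x -> b (x + d) intertwines the quadratic with squaring, so n iterations become a
  \<open>2 ^ n\<close>-th power.\<close>

lemma poly_iterate_quadratic:
  fixes b d :: "'a::field"
  shows "[:b:] * poly_iterate n ([:b:] * [:d, 1:]\<^sup>2 - [:d:]) = [:b * d, b:] ^ 2 ^ n - [:b * d:]"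
proof (induction n)
  case 0
  then show ?case
    by (simp add: poly_iterate_def)
next
  case (Suc n)
  let ?f = "[:b:] * [:d, 1:]\<^sup>2 - [:d:]"
  let ?g = "poly_iterate n ?f"
  have "[:b:] * poly_iterate (Suc n) ?f = [:b:] * pcompose ?f ?g"
    by (simp add: poly_iterate_def)
  also have "pcompose ?f ?g = [:b:] * ([:d:] + ?g)\<^sup>2 - [:d:]"
    unfolding power2_eq_square pcompose_diff pcompose_mult by (simp add: pcompose_pCons)
  also have "[:b:] * \<dots> = ([:b:] * ?g + [:b * d:])\<^sup>2 - [:b * d:]"
    by (simp add: power2_eq_square algebra_simps smult_add_right)
  also have "\<dots> = ([:b * d, b:] ^ 2 ^ n)\<^sup>2 - [:b * d:]"
    unfolding Suc.IH by simp
  also have "\<dots> = [:b * d, b:] ^ 2 ^ Suc n - [:b * d:]"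
    by (simp add: power_mult[symmetric] mult.commute)
  finally show ?case .
qed

theorem theorem3p1:
  fixes a b c :: "'a::finite_field" and q :: nat
  assumes "primepow q" and "odd q" and "CARD('a) = q"
    and "b \<noteq> 0"
    and "\<not> is_square (4 * a * b + 2 * c)"
  shows "stable_poly
           ([:b:] * [:a, 1:]\<^sup>2 + [:c:] * [:a, 1:] - [:a:] + [:(c\<^sup>2 - 2 * c) / (4 * b):])
         \<longleftrightarrow> [q = 1] (mod 4)"
proof -
  have "(2 :: 'a) \<noteq> 0"
  proof
    assume "(2 :: 'a) = 0"
    then have "4 * a * b + 2 * c = 0"
      by (metis add.right_neutral mult_2 mult_zero_left numeral_Bit0)
    then show False
      using assms(5) by simp
  qed
  then have four: "(4 :: 'a) \<noteq> 0"
    by (metis mult_2 no_zero_divisors numeral_Bit0)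
  define d where "d = a + c / (2 * b)"
  have "4 * a * b + 2 * c = 2\<^sup>2 * (b * d)"
    using \<open>b \<noteq> 0\<close> \<open>(2 :: 'a) \<noteq> 0\<close> by (simp add: d_def field_simps)
  \<comment> \<open>The factor 4 is itself a square, so a square \<open>b * d\<close> would make
    \<open>4 * a * b + 2 * c\<close> a square.\<close>
  then have e: "\<not> is_square (b * d)"
    using assms(5) by (metis is_nth_power_mult is_nth_power_nth_power)
  have f: "[:b:] * [:a, 1:]\<^sup>2 + [:c:] * [:a, 1:] - [:a:] + [:(c\<^sup>2 - 2 * c) / (4 * b):]
      = [:b:] * [:d, 1:]\<^sup>2 - [:d:]" (is "?f = _")
  proof -
    \<comment> \<open>With \<open>c = 2 * b * u\<close> the last constant becomes
      \<open>b * u\<^sup>2 - u\<close>: the first term completes the square, the second turns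
      \<open>- a\<close> into \<open>- d\<close>.\<close>
    define u where "u = c / (2 * b)"
    have c: "c = 2 * b * u" and "d = a + u"
      using \<open>b \<noteq> 0\<close> \<open>(2 :: 'a) \<noteq> 0\<close> by (simp_all add: u_def d_def)
    moreover have "(c\<^sup>2 - 2 * c) / (4 * b) = b * u\<^sup>2 - u"
      using \<open>b \<noteq> 0\<close> four unfolding c by (simp add: power2_eq_square field_simps)
    ultimately show ?thesis
      by (simp add: power2_eq_square algebra_simps)
  qed
  have l: "degree [:b * d, b:] = 1"
    using \<open>b \<noteq> 0\<close> by simp
  have "[:b:] dvd 1"
    using \<open>b \<noteq> 0\<close> by (simp add: is_unit_const_poly_iff dvd_field_iff)
  then have iter: "irreducible (poly_iterate n ?f) \<longleftrightarrow>
      irreducible ([:b * d, b:] ^ 2 ^ n - [:b * d:])" for n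
    unfolding f poly_iterate_quadratic[symmetric] by (rule irreducible_mult_unit_left[symmetric])
  show ?thesis
  proof
    assume "stable_poly ?f"
    \<comment> \<open>The second iterate already gives the fourth power that factors when q is 3
      modulo 4.\<close>
    then have "irreducible ([:b * d, b:] ^ 2 ^ 2 - [:b * d:])"
      using iter[of 2] by (simp add: stable_poly_def)
    then have "CARD('a) mod 4 \<noteq> 3"
      using reducible_fourth_power_minus_nonsquare[OF _ \<open>2 \<noteq> 0\<close> e l] by auto
    then show "[q = 1] (mod 4)"
      using assms(2,3) unfolding cong_def by presburger
  next
    assume "[q = 1] (mod 4)"
    then have "CARD('a) mod 4 = 1"
      using assms(3) by (simp add: cong_def)
    then show "stable_poly ?f"
      using irreducible_two_power_minus_nonsquare[OF _ e l] iter by (simp add: stable_poly_def)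
  qed
qed

end
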